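(* Let $p$ be the transition kernel of a time-homogeneous Markov chain of order $m\ge1$ on a finite alphabet $A$, with skeleton of order $K$ and skeleton matrix $\mathbb{M}$ (a $\{0,1\}$-matrix indexed by $A^K\times A^K$). Then $\mathbb{M}$ has a unique closed class if and only if the matrix $\sum_{n=1}^{|A|^K}\mathbb{M}^n$, where sums and powers are Boolean, has a column all of whose entries are equal to $1$.
   Context: Words: $A$ is a finite set. For $\mathbf{x}\in A^k$, $\mathbf{x}_i^j=(x_i,\dots,x_j)$ for $1\le i\le j\le k$, and $\mathbf{x}_i^j=\mathbf{e}$ (the empty word) if $i>j$; $A^0=\{\mathbf{e}\}$. Juxtaposition denotes concatenation. Kernel: $p:A^m\times A\to[0,1]$, $p(\mathbf{x},a)=P(X_{n+1}=a\mid X_n=x_m,X_{n-1}=x_{m-1},\dots,X_{n-m+1}=x_1)$, so $x_m$ is the most recent symbol, and $\sum_{a\in A}p(\mathbf{x},a)=1$. Skeleton order: for $\mathbf{x}\in A^m$ and $a\in A$, $$\tau(\mathbf{x},a)=\min\{i\ge 0:\ p(\mathbf{y}\mathbf{x}_{m-i}^m,a)=0\ \forall \mathbf{y}\in A^{m-i-1},\ \text{or}\ p(\mathbf{y}\mathbf{x}_{m-i}^m,a)>0\ \forall \mathbf{y}\in A^{m-i-1}\},$$ $\tau_{\mathbf{x}}=\sup_{a\in A}\tau(\mathbf{x},a)$. The skeleton of $p$ is $\mathcal{S}=\bigcup_{\mathbf{x}\in A^m}\{\mathbf{x}_{m-\tau_{\mathbf{x}}}^m\}$ and its order is $K=1+\sup_{\mathbf{x}\in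 A^m}\tau_{\mathbf{x}}\in\{1,\dots,m\}$. Skeleton matrix: $\mathbb{M}$ is the $\{0,1\}$-matrix indexed by $A^K\times A^K$ with $\mathbb{M}(\mathbf{u},\mathbf{v})=1$ if $(\mathbf{u},\mathbf{v})=(\mathbf{x}_1^K,\mathbf{x}_2^K a)$ for some $\mathbf{x}\in A^K$, $a\in A$ such that $p(\mathbf{y}\mathbf{x}_1^K,a)>0$ for all $\mathbf{y}\in A^{m-K}$, and $\mathbb{M}(\mathbf{u},\mathbf{v})=0$ otherwise. Classes: operations on $\{0,1\}$-matrices are Boolean ($1+1=1$). For a binary matrix $B$ on a finite set $E$, communicating classes are defined as for stochastic matrices (accessibility of $l$ from $k$ meaning $B^n(k,l)=1$ for some $n\ge0$). A communicating class $\mathcal{C}$ is closed if $B^n(k,l)=0$ for all $k\in\mathcal{C}$, $l\notin\mathcal{C}$, $n\ge1$. *)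

theory Defs
  imports Complex_Main "HOL-Library.NList"
begin

(* Words of length k over A are lists, A^k is "nlists k A". Positions are counted from 1 and the
   last letter is the most recent one. *)

definition subword :: "'a list \<Rightarrow> nat \<Rightarrow> nat \<Rightarrow> 'a list" where
  "subword x i j = drop (i - 1) (take j x)"

definition transition_kernel :: "'a set \<Rightarrow> nat \<Rightarrow> ('a list \<Rightarrow> 'a \<Rightarrow> real) \<Rightarrow> bool" where
  "transition_kernel A m p \<longleftrightarrow>
     (\<forall>x\<in>nlists m A. (\<forall>a\<in>A. 0 \<le> p x a \<and> p x a \<le> 1) \<and> (\<Sum>a\<in>A. p x a) = 1)"

(* For m >= 1 and x of length m, the index i = m - 1 satisfies the condition (y is then empty), so
   the minimum is at most m - 1 and truncated subtraction never matters. *)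
definition tau :: "'a set \<Rightarrow> nat \<Rightarrow> ('a list \<Rightarrow> 'a \<Rightarrow> real) \<Rightarrow> 'a list \<Rightarrow> 'a \<Rightarrow> nat" where
  "tau A m p x a = (LEAST i.
     (\<forall>y\<in>nlists (m - i - 1) A. p (y @ subword x (m - i) m) a = 0) \<or>
     (\<forall>y\<in>nlists (m - i - 1) A. p (y @ subword x (m - i) m) a > 0))"

definition tau_word :: "'a set \<Rightarrow> nat \<Rightarrow> ('a list \<Rightarrow> 'a \<Rightarrow> real) \<Rightarrow> 'a list \<Rightarrow> nat" where
  "tau_word A m p x = (SUP a\<in>A. tau A m p x a)"

definition skeleton_order :: "'a set \<Rightarrow> nat \<Rightarrow> ('a list \<Rightarrow> 'a \<Rightarrow> real) \<Rightarrow> nat" where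
  "skeleton_order A m p = 1 + (SUP x\<in>nlists m A. tau_word A m p x)"

(* A {0,1}-matrix indexed by a finite set E is a function to the Boolean semiring bool
   (True is 1, disjunction is +, conjunction is the product), read on E only. *)

type_synonym 'e bmat = "'e \<Rightarrow> 'e \<Rightarrow> bool"

definition bmat_mult :: "'e set \<Rightarrow> 'e bmat \<Rightarrow> 'e bmat \<Rightarrow> 'e bmat" where
  "bmat_mult E B C k l \<longleftrightarrow> (\<exists>h\<in>E. B k h \<and> C h l)"

primrec bmat_pow :: "'e set \<Rightarrow> 'e bmat \<Rightarrow> nat \<Rightarrow> 'e bmat" where
  "bmat_pow E B 0 = (\<lambda>k l. k = l)"
| "bmat_pow E B (Suc n) = bmat_mult E (bmat_pow E B n) B"

definition bmat_sum :: "nat set \<Rightarrow> (nat \<Rightarrow> 'e bmat) \<Rightarrow> 'e bmat" where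
  "bmat_sum I F k l \<longleftrightarrow> (\<exists>n\<in>I. F n k l)"

definition accessible :: "'e set \<Rightarrow> 'e bmat \<Rightarrow> 'e \<Rightarrow> 'e \<Rightarrow> bool" where
  "accessible E B k l \<longleftrightarrow> (\<exists>n. bmat_pow E B n k l)"

definition communication_rel :: "'e set \<Rightarrow> 'e bmat \<Rightarrow> ('e \<times> 'e) set" where
  "communication_rel E B =
     {(k, l). k \<in> E \<and> l \<in> E \<and> accessible E B k l \<and> accessible E B l k}"

definition communicating_classes :: "'e set \<Rightarrow> 'e bmat \<Rightarrow> 'e set set" where
  "communicating_classes E B = E // communication_rel E B"

definition closed_class :: "'e set \<Rightarrow> 'e bmat \<Rightarrow> 'e set \<Rightarrow> bool" where
  "closed_class E B C \<longleftrightarrow> C \<in> communicating_classes E B \<and>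
     (\<forall>k\<in>C. \<forall>l\<in>E - C. \<forall>n\<ge>1. \<not> bmat_pow E B n k l)"

definition skeleton_matrix :: "'a set \<Rightarrow> nat \<Rightarrow> ('a list \<Rightarrow> 'a \<Rightarrow> real) \<Rightarrow> 'a list bmat" where
  "skeleton_matrix A m p u v \<longleftrightarrow> (let K = skeleton_order A m p in
     \<exists>x\<in>nlists K A. \<exists>a\<in>A. (u, v) = (subword x 1 K, subword x 2 K @ [a]) \<and>
       (\<forall>y\<in>nlists (m - K) A. p (y @ subword x 1 K) a > 0))"

end

theory Submission imports Defs begin

text \<open>
  In a finite directed graph every vertex reaches a closed class: among the vertices accessible
  from it, one whose own set of accessible vertices has least cardinality generates such a class.
  If moreover every vertex has a successor, then a vertex of the unique closed class is reached
  from everywhere by a path of positive length, which can be shortened to at most as many steps as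
  there are vertices. Conversely, a vertex reached from everywhere lies in every closed class.
  Every row of the skeleton matrix is nonzero because some transition probability from each past is
  positive, and its positivity depends on the last \<open>K\<close> letters only.
\<close>

text \<open>A relation, so that the theory of \<open>relpow\<close> and \<open>rtrancl\<close>
  applies; it is cut down to \<open>E\<close> because Boolean products sum over \<open>E\<close>
  only.\<close>

definition edges :: "'e set \<Rightarrow> 'e bmat \<Rightarrow> ('e \<times> 'e) set" where
  "edges E B = {(k, l). k \<in> E \<and> l \<in> E \<and> B k l}"

lemma bmat_pow_iff_relpow:
  assumes "k \<in> E" "l \<in> E"
  shows "bmat_pow E B n k l \<longleftrightarrow> (k, l) \<in> edges E B ^^ n"
  using assms(2)
proof (induction n arbitrary: l)
  case (Suc n)
  then show ?case
    using assms(1) by (auto simp: bmat_mult_def edges_def relcomp_unfold)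
qed simp

lemma accessible_iff_rtrancl:
  assumes "k \<in> E" "l \<in> E"
  shows "accessible E B k l \<longleftrightarrow> (k, l) \<in> (edges E B)\<^sup>*"
  using bmat_pow_iff_relpow[OF assms] by (simp add: accessible_def rtrancl_power)

lemma edges_rtrancl_closed:
  assumes "(k, l) \<in> (edges E B)\<^sup>*" "k \<in> E"
  shows "l \<in> E"
  using assms by (induction rule: rtrancl_induct) (auto simp: edges_def)

lemma communication_rel_Image:
  assumes "k \<in> E"
  shows "communication_rel E B `` {k} = {l. (k, l) \<in> (edges E B)\<^sup>* \<and> (l, k) \<in> (edges E B)\<^sup>*}"
  using assms edges_rtrancl_closed[of k _ E B] accessible_iff_rtrancl[of _ E _ B]
  by (auto simp: communication_rel_def)

text \<open>No path leaves a closed class, so it is the full reach set of any member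
  \<open>w\<close>; closedness then means that everything reachable from \<open>w\<close> leads back
  to \<open>w\<close>.\<close>

lemma closed_class_iff:
  "closed_class E B C \<longleftrightarrow>
     (\<exists>w\<in>E. C = (edges E B)\<^sup>* `` {w} \<and> (\<forall>l\<in>C. (l, w) \<in> (edges E B)\<^sup>*))"
proof
  let ?R = "edges E B"
  assume C: "closed_class E B C"
  then obtain w where w: "w \<in> E" "C = {l. (w, l) \<in> ?R\<^sup>* \<and> (l, w) \<in> ?R\<^sup>*}"
    by (auto simp: closed_class_def communicating_classes_def quotient_def communication_rel_Image)
  have "l \<in> C" if l: "(w, l) \<in> ?R\<^sup>*" for l
  proof (rule ccontr)
    assume "l \<notin> C"
    \<comment> \<open>Closedness only concerns powers \<open>n \<ge> 1\<close>, so the empty path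
      must be ruled out.\<close>
    have "l \<noteq> w" using \<open>l \<notin> C\<close> w by auto
    then obtain n where n: "n \<ge> 1" "(w, l) \<in> ?R ^^ n"
      using l by (metis One_nat_def Suc_leI rtrancl_eq_or_trancl trancl_power)
    have "l \<in> E" using l w(1) by (rule edges_rtrancl_closed)
    then have "bmat_pow E B n w l" using n w(1) by (simp add: bmat_pow_iff_relpow)
    moreover have "w \<in> C" using w by simp
    ultimately show False using C n(1) \<open>l \<in> E\<close> \<open>l \<notin> C\<close> by (auto simp: closed_class_def)
  qed
  then show "\<exists>w\<in>E. C = ?R\<^sup>* `` {w} \<and> (\<forall>l\<in>C. (l, w) \<in> ?R\<^sup>*)"
    using w by (intro bexI[of _ w]) auto
next
  let ?R = "edges E B"
  assume "\<exists>w\<in>E. C = ?R\<^sup>* `` {w} \<and> (\<forall>l\<in>C. (l, w) \<in> ?R\<^sup>*)"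
  then obtain w where w: "w \<in> E" "C = ?R\<^sup>* `` {w}" "\<And>l. l \<in> C \<Longrightarrow> (l, w) \<in> ?R\<^sup>*"
    by auto
  have "C = communication_rel E B `` {w}"
    using w by (auto simp: communication_rel_Image)
  then have "C \<in> communicating_classes E B"
    using w(1) by (auto simp: communicating_classes_def quotient_def)
  moreover have "l \<in> C" if "k \<in> C" "l \<in> E" "bmat_pow E B n k l" for k l n
  proof -
    have "(w, k) \<in> ?R\<^sup>*" using that(1) w(2) by simp
    moreover from this have "k \<in> E" using w(1) by (rule edges_rtrancl_closed)
    then have "(k, l) \<in> ?R\<^sup>*"
      using that accessible_iff_rtrancl[of k E l B] by (auto simp: accessible_def)
    ultimately show ?thesis using w(2) by (auto intro: rtrancl_trans)
  qed
  ultimately show "closed_class E B C" by (auto simp: closed_class_def)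
qed

lemma accessible_closed_class_exists:
  assumes "finite E" "k \<in> E"
  obtains C where "closed_class E B C" "C \<subseteq> (edges E B)\<^sup>* `` {k}"
proof -
  let ?R = "edges E B"
  define w where "w = arg_min_on (\<lambda>x. card (?R\<^sup>* `` {x})) (?R\<^sup>* `` {k})"
  have sub: "?R\<^sup>* `` {k} \<subseteq> E" using edges_rtrancl_closed assms(2) by fastforce
  then have fin: "finite (?R\<^sup>* `` {k})" using assms(1) by (rule finite_subset)
  have ne: "?R\<^sup>* `` {k} \<noteq> {}" by auto
  have w: "(k, w) \<in> ?R\<^sup>*" unfolding w_def using arg_min_if_finite(1)[OF fin ne] by auto
  have least: "card (?R\<^sup>* `` {w}) \<le> card (?R\<^sup>* `` {x})" if "(k, x) \<in> ?R\<^sup>*" for x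
    unfolding w_def using arg_min_least[OF fin ne] that by simp
  have wk: "?R\<^sup>* `` {w} \<subseteq> ?R\<^sup>* `` {k}" using w by (auto intro: rtrancl_trans)
  \<comment> \<open>The reach set of \<open>l\<close> lies inside that of \<open>w\<close> and by
    minimality is no smaller, so the two coincide and \<open>w\<close> is reachable from
    \<open>l\<close>.\<close>
  have return: "(l, w) \<in> ?R\<^sup>*" if l: "(w, l) \<in> ?R\<^sup>*" for l
  proof -
    have "?R\<^sup>* `` {l} \<subseteq> ?R\<^sup>* `` {w}" using l by (auto intro: rtrancl_trans)
    moreover have "card (?R\<^sup>* `` {w}) \<le> card (?R\<^sup>* `` {l})"
      by (rule least) (rule rtrancl_trans[OF w l])
    ultimately have "?R\<^sup>* `` {l} = ?R\<^sup>* `` {w}"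
      using card_seteq finite_subset[OF wk fin] by blast
    then show ?thesis by auto
  qed
  have "w \<in> E" using w assms(2) by (rule edges_rtrancl_closed)
  then have "closed_class E B (?R\<^sup>* `` {w})"
    unfolding closed_class_iff using return by auto
  then show ?thesis using wk by (rule that)
qed

text \<open>Pigeonhole: a shortest path of positive length visits pairwise distinct vertices at
  times \<open>1\<close> to \<open>n\<close>.\<close>

lemma trancl_imp_short_relpow:
  assumes "finite E" "R \<subseteq> E \<times> E" "(k, l) \<in> R\<^sup>+"
  shows "\<exists>n\<in>{1..card E}. (k, l) \<in> R ^^ n"
proof -
  let ?P = "\<lambda>n. 0 < n \<and> (k, l) \<in> R ^^ n"
  define n where "n = (LEAST n. ?P n)"
  have "\<exists>n. ?P n" using assms(3) by (simp add: trancl_power)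
  then have n: "?P n" unfolding n_def by (rule LeastI_ex)
  have min: "n \<le> j" if "?P j" for j unfolding n_def using that by (rule Least_le)
  obtain f where f: "f 0 = k" "f n = l" "\<And>i. i < n \<Longrightarrow> (f i, f (Suc i)) \<in> R"
    using n by (auto simp: relpow_fun_conv)
  have seg: "(f i, f (i + d)) \<in> R ^^ d" if "i + d \<le> n" for i d
    using f(3) that by (auto simp: relpow_fun_conv intro!: exI[of _ "\<lambda>j. f (i + j)"])
  \<comment> \<open>Cutting out the loop between times \<open>i\<close> and \<open>j\<close> would
    give a shorter path, still of positive length since \<open>i \<ge> 1\<close>. Time
    \<open>0\<close> is excluded because \<open>k = l\<close> is allowed.\<close>
  have ne: "f i \<noteq> f j" if "1 \<le> i" "i < j" "j \<le> n" for i j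
  proof
    assume eq: "f i = f j"
    have "(k, f i) \<in> R ^^ i" using seg[of 0 i] f(1) that by simp
    moreover have "(f i, l) \<in> R ^^ (n - j)" using seg[of j "n - j"] f(2) that eq by simp
    ultimately have "(k, l) \<in> R ^^ (i + (n - j))" unfolding relpow_add by blast
    then have "n \<le> i + (n - j)" using min that by simp
    then show False using that by simp
  qed
  have "inj_on f {1..n}"
    by (rule inj_onI) (metis atLeastAtMost_iff linorder_neqE_nat ne)
  moreover have "f ` {1..n} \<subseteq> E"
  proof
    fix x assume "x \<in> f ` {1..n}"
    then obtain i where "x = f (Suc i)" "i < n"
      by (metis Suc_le_eq atLeastAtMost_iff imageE not0_implies_Suc not_one_le_zero)
    then show "x \<in> E" using f(3) assms(2) by blast
  qed
  ultimately have "card {1..n} \<le> card E" using assms(1) by (rule card_inj_on_le)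
  then show ?thesis using n by auto
qed

text \<open>The sum starts at \<open>n = 1\<close>, whence \<open>total\<close>: a vertex without
  successors forms a closed class on its own, yet its row of the sum is zero.\<close>

lemma unique_closed_class_iff_full_column:
  assumes "finite E" and total: "\<And>k. k \<in> E \<Longrightarrow> \<exists>l\<in>E. B k l"
  shows "(\<exists>!C. closed_class E B C) \<longleftrightarrow>
    (\<exists>v\<in>E. \<forall>u\<in>E. bmat_sum {1..card E} (bmat_pow E B) u v)"
proof
  let ?R = "edges E B"
  assume "\<exists>!C. closed_class E B C"
  then obtain C where C: "closed_class E B C" and uniq: "\<And>D. closed_class E B D \<Longrightarrow> D = C"
    by auto
  obtain v where v: "v \<in> E" "v \<in> C" using C unfolding closed_class_iff by auto
  have "bmat_sum {1..card E} (bmat_pow E B) u v" if u: "u \<in> E" for u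
  proof -
    \<comment> \<open>Moving to a successor first makes the path to \<open>v\<close> nonempty, even
      when \<open>u = v\<close>.\<close>
    obtain u' where u': "u' \<in> E" "(u, u') \<in> ?R" using total[OF u] u by (auto simp: edges_def)
    obtain D where "closed_class E B D" "D \<subseteq> ?R\<^sup>* `` {u'}"
      using accessible_closed_class_exists[OF assms(1) u'(1)] .
    then have "(u', v) \<in> ?R\<^sup>*" using uniq v(2) by auto
    then have "(u, v) \<in> ?R\<^sup>+" using u'(2) by (rule rtrancl_into_trancl2[rotated])
    moreover have "?R \<subseteq> E \<times> E" by (auto simp: edges_def)
    ultimately obtain n where "n \<in> {1..card E}" "(u, v) \<in> ?R ^^ n"
      using trancl_imp_short_relpow[OF assms(1)] by blast
    then show ?thesis
      using bmat_pow_iff_relpow[OF u v(1)] by (auto simp: bmat_sum_def)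
  qed
  then show "\<exists>v\<in>E. \<forall>u\<in>E. bmat_sum {1..card E} (bmat_pow E B) u v" using v(1) by blast
next
  let ?R = "edges E B"
  assume "\<exists>v\<in>E. \<forall>u\<in>E. bmat_sum {1..card E} (bmat_pow E B) u v"
  then obtain v where v: "v \<in> E" and col: "\<And>u. u \<in> E \<Longrightarrow> accessible E B u v"
    by (auto simp: bmat_sum_def accessible_def) blast
  have acc: "(u, v) \<in> ?R\<^sup>*" if "u \<in> E" for u
    using col[OF that] accessible_iff_rtrancl[OF that v] by simp
  \<comment> \<open>The generator \<open>w\<close> of \<open>C\<close> reaches \<open>v\<close>,
    hence \<open>v\<close> lies in \<open>C\<close> and reaches \<open>w\<close>; their reach sets
    agree.\<close>
  have eq: "C = ?R\<^sup>* `` {v}" if "closed_class E B C" for C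
  proof -
    obtain w where w: "w \<in> E" "C = ?R\<^sup>* `` {w}" "\<forall>l\<in>C. (l, w) \<in> ?R\<^sup>*"
      using \<open>closed_class E B C\<close> unfolding closed_class_iff by auto
    then have "(w, v) \<in> ?R\<^sup>*" "(v, w) \<in> ?R\<^sup>*" using acc by auto
    then show ?thesis using w(2) by (auto intro: rtrancl_trans)
  qed
  obtain C where "closed_class E B C"
    using accessible_closed_class_exists[OF assms(1) v] .
  then show "\<exists>!C. closed_class E B C" using eq by blast
qed

lemma finite_nlists: "finite A \<Longrightarrow> finite (nlists n A)"
  unfolding nlists_def using finite_lists_length_eq[of A n] by (metis (no_types, lifting) Collect_cong conj_commute)

lemma card_nlists: "finite A \<Longrightarrow> card (nlists n A) = card A ^ n"
  unfolding nlists_def using card_lists_length_eq[of A n] by (metis (no_types, lifting) Collect_cong conj_commute)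

context
  fixes A :: "'a set" and m :: nat and p :: "'a list \<Rightarrow> 'a \<Rightarrow> real"
  assumes fin: "finite A" and m: "m \<ge> 1" and p: "transition_kernel A m p"
begin

text \<open>The condition minimised in \<open>tau\<close>: the last \<open>i + 1\<close> letters of
  \<open>x\<close> decide whether \<open>a\<close> can come next.\<close>

abbreviation sign_determined :: "'a list \<Rightarrow> 'a \<Rightarrow> nat \<Rightarrow> bool" where
  "sign_determined x a i \<equiv>
     (\<forall>y\<in>nlists (m - i - 1) A. p (y @ subword x (m - i) m) a = 0) \<or>
     (\<forall>y\<in>nlists (m - i - 1) A. p (y @ subword x (m - i) m) a > 0)"

lemma tau_props:
  assumes "x \<in> nlists m A" "a \<in> A"
  shows "sign_determined x a (tau A m p x a)" and "tau A m p x a \<le> m - 1"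
proof -
  have "p x a \<ge> 0" using p assms by (auto simp: transition_kernel_def)
  then have last: "sign_determined x a (m - 1)"
    using m assms(1) by (auto simp: subword_def)
  show "sign_determined x a (tau A m p x a)" unfolding tau_def using last by (rule LeastI)
  show "tau A m p x a \<le> m - 1" unfolding tau_def using last by (rule Least_le)
qed

text \<open>The deciding suffix has \<open>tau A m p x a + 1\<close> letters, so the strict bound
  makes it fit into a word of length \<open>K\<close>.\<close>

lemma tau_less_skeleton_order:
  assumes "x \<in> nlists m A" "a \<in> A"
  shows "tau A m p x a < skeleton_order A m p"
proof -
  have "tau A m p x a \<le> tau_word A m p x"
    unfolding tau_word_def using assms fin by (intro cSUP_upper) auto
  also have "\<dots> \<le> (SUP x\<in>nlists m A. tau_word A m p x)"
    using assms fin by (intro cSUP_upper) (auto simp: finite_nlists)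
  finally show ?thesis by (simp add: skeleton_order_def)
qed

lemma skeleton_order_le:
  assumes "A \<noteq> {}"
  shows "skeleton_order A m p \<le> m"
proof -
  have ne: "nlists m A \<noteq> {}" using nlists_not_empty[OF assms] by auto
  have "tau_word A m p x \<le> m - 1" if "x \<in> nlists m A" for x
    unfolding tau_word_def using assms tau_props(2)[OF that] by (intro cSUP_least)
  then have "(SUP x\<in>nlists m A. tau_word A m p x) \<le> m - 1"
    using ne by (intro cSUP_least)
  then show ?thesis using m by (simp add: skeleton_order_def)
qed

lemma skeleton_matrix_row_nonzero:
  fixes K defines "K \<equiv> skeleton_order A m p"
  assumes u: "u \<in> nlists K A"
  shows "\<exists>v\<in>nlists K A. skeleton_matrix A m p u v"
proof -
  have K1: "K \<ge> 1" by (simp add: K_def skeleton_order_def)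
  have len: "length u = K" "set u \<subseteq> A" using u by auto
  then have ne: "A \<noteq> {}" using K1 by auto
  then obtain b where b: "b \<in> A" by auto
  have Km: "K \<le> m" unfolding K_def using ne by (rule skeleton_order_le)
  \<comment> \<open>Some past of length \<open>m\<close> ending in \<open>u\<close>; the padding
    letter is arbitrary.\<close>
  define x where "x = replicate (m - K) b @ u"
  have x: "x \<in> nlists m A" unfolding x_def using b len Km by (intro nlistsI) auto
  have "(\<Sum>a\<in>A. p x a) = 1" "\<forall>a\<in>A. p x a \<ge> 0"
    using p x by (auto simp: transition_kernel_def)
  then obtain a where a: "a \<in> A" "p x a > 0"
    by (metis less_eq_real_def sum.neutral zero_neq_one)
  define i where "i = tau A m p x a"
  have i: "i < K" unfolding i_def K_def using x a(1) by (rule tau_less_skeleton_order)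
  \<comment> \<open>The last \<open>i + 1\<close> letters of \<open>u\<close>, which form the suffix
    of \<open>x\<close> deciding the sign for \<open>a\<close>.\<close>
  define s where "s = drop (K - Suc i) u"
  have s: "subword x (m - i) m = s"
    using i Km len(1) by (simp add: subword_def x_def s_def)
  have split: "z @ u = (z @ take (K - Suc i) u) @ s" for z
    unfolding s_def by simp
  have mem: "z @ take (K - Suc i) u \<in> nlists (m - i - 1) A" if "z \<in> nlists (m - K) A" for z
    using that len i Km by (intro nlistsI) (auto dest: in_set_takeD)
  have b_mem: "replicate (m - K) b \<in> nlists (m - K) A" using b ..
  have "p ((replicate (m - K) b @ take (K - Suc i) u) @ s) a > 0"
    using a(2) split unfolding x_def by metis
  \<comment> \<open>Positivity at the single past \<open>x\<close> excludes the alternative that all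
    these values vanish.\<close>
  then have "\<forall>y\<in>nlists (m - i - 1) A. p (y @ s) a > 0"
    using tau_props(1)[OF x a(1)] mem[OF b_mem] unfolding i_def[symmetric] s by (metis less_irrefl)
  then have pos: "p (z @ u) a > 0" if "z \<in> nlists (m - K) A" for z
    using mem[OF that] split by metis
  have "subword u 1 K = u" using len by (simp add: subword_def)
  moreover have "subword u 2 K @ [a] \<in> nlists K A"
    using len K1 a(1) by (intro nlistsI) (auto simp: subword_def dest: in_set_dropD)
  ultimately show ?thesis
    using u a(1) pos unfolding skeleton_matrix_def Let_def K_def[symmetric]
    by (intro bexI[of _ "subword u 2 K @ [a]"] bexI[of _ u] bexI[of _ a]) auto
qed

end

theorem proposition1:
  fixes A :: "'a set" and m K :: nat and p :: "'a list \<Rightarrow> 'a \<Rightarrow> real" and M :: "'a list bmat"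
  assumes "finite A" and "m \<ge> 1" and "transition_kernel A m p"
    and "K = skeleton_order A m p" and "M = skeleton_matrix A m p"
  shows "(\<exists>!C. closed_class (nlists K A) M C) \<longleftrightarrow>
    (\<exists>v\<in>nlists K A. \<forall>u\<in>nlists K A.
       bmat_sum {1..card A ^ K} (\<lambda>n. bmat_pow (nlists K A) M n) u v)"
  \<comment> \<open>For \<open>E = nlists K A\<close> the bound \<open>card E\<close> on the path
    length is \<open>card A ^ K\<close>.\<close>
  using unique_closed_class_iff_full_column[of "nlists K A" M]
    skeleton_matrix_row_nonzero[OF assms(1-3)] assms
  by (simp add: finite_nlists card_nlists)

end
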